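(* Write $\Theta_n=\{\phi_1,\dots,\phi_s\}$ and let $I,J\subseteq\{1,\dots,s\}$. The rule $r=\frac{\bigvee_{i\in I}\phi_i\vee\bigvee_{j\in J}\phi_j}{\bigvee_{j\in J}\phi_j}$ is invalid in some $S4$-model iff there is a set $W\subseteq\{\phi_i\in\Theta_n\mid i\in I\cup J\}$ such that (1) $\mathcal M(\Theta_n,W),\phi_j\models\phi_j$ for all $\phi_j\in W$; (2) $\mathcal M(\Theta_n,W)\models\bigvee_{i\in I}\phi_i\vee\bigvee_{j\in J}\phi_j$; (3) there is $i\in I$ with $\phi_i\in W$ and $\mathcal M(\Theta_n,W),\phi_i\not\models\bigvee_{j\in J}\phi_j$; (4) $r$ is invalid in $\mathcal M(\Theta_n,W)$.
   Context: $S4$-models are Kripke models with reflexive transitive accessibility; $\mathcal M\models\psi$ means $\psi$ is true at every world of $\mathcal M$; $\diamond=\neg\Box\neg$. A rule $\frac{\alpha}{\beta}$ is valid in a model if $\mathcal M\models\alpha$ implies $\mathcal M\models\beta$, invalid otherwise. Fix variables $p_1,\dots,p_n$; $\alpha^1=\alpha$, $\alpha^0=\neg\alpha$. $\Theta_n$ is the set of all disjuncts $\bigwedge_{i=1}^n p_i^{t(i,0)}\wedge\bigwedge_{i=1}^n(\diamond p_i)^{t(i,1)}$, $t:\{1,\dots,n\}\times\{0,1\}\to\{0,1\}$. For such $\phi$, $\theta(\phi)=\{p_i\mid t(i,0)=1\}$, $\theta_\diamond(\phi)=\{p_i\mid t(i,1)=1\}$. For $W\subseteq\Theta_n$, $\mathcal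 M(\Theta_n,W)$ is the Kripke model with worlds $W$, $\phi R\psi$ iff $\theta_\diamond(\psi)\subseteq\theta_\diamond(\phi)$, and $p_i$ true at $\phi$ iff $p_i\in\theta(\phi)$. *)

theory Defs
  imports Main "HOL-Library.FuncSet"
begin

datatype fm =
    Var nat
  | Bot
  | Neg fm
  | And fm fm
  | Or fm fm
  | Box fm

definition Top :: fm where
  "Top = Neg Bot"

definition Dia :: "fm \<Rightarrow> fm" where
  "Dia a = Neg (Box (Neg a))"

fun Conj :: "fm list \<Rightarrow> fm" where
  "Conj [] = Top"
| "Conj [a] = a"
| "Conj (a # b # as) = And a (Conj (b # as))"

fun Disj :: "fm list \<Rightarrow> fm" where
  "Disj [] = Bot"
| "Disj [a] = a"
| "Disj (a # b # as) = Or a (Disj (b # as))"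

record 'w kripke =
  worlds :: "'w set"
  acc :: "'w \<Rightarrow> 'w \<Rightarrow> bool"
  val :: "nat \<Rightarrow> 'w \<Rightarrow> bool"

text \<open>Only the behaviour of \<open>acc\<close> and \<open>val\<close> on \<open>worlds\<close> matters.\<close>

primrec sat :: "'w kripke \<Rightarrow> 'w \<Rightarrow> fm \<Rightarrow> bool" where
  "sat M w (Var i) = val M i w"
| "sat M w Bot = False"
| "sat M w (Neg a) = (\<not> sat M w a)"
| "sat M w (And a b) = (sat M w a \<and> sat M w b)"
| "sat M w (Or a b) = (sat M w a \<or> sat M w b)"
| "sat M w (Box a) = (\<forall>v\<in>worlds M. acc M w v \<longrightarrow> sat M v a)"

definition true_in :: "'w kripke \<Rightarrow> fm \<Rightarrow> bool" where
  "true_in M a \<longleftrightarrow> (\<forall>w\<in>worlds M. sat M w a)"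

definition S4_model :: "'w kripke \<Rightarrow> bool" where
  "S4_model M \<longleftrightarrow>
     worlds M \<noteq> {} \<and> reflp_on (worlds M) (acc M) \<and> transp_on (worlds M) (acc M)"

text \<open>A rule is the pair of its premise and its conclusion.\<close>

definition rule_valid :: "'w kripke \<Rightarrow> fm \<times> fm \<Rightarrow> bool" where
  "rule_valid M r \<longleftrightarrow> (true_in M (fst r) \<longrightarrow> true_in M (snd r))"

text \<open>\<open>lit a 1\<close> and \<open>lit a 0\<close> are $\alpha^1 = \alpha$ and $\alpha^0 = \neg\alpha$.\<close>

definition lit :: "fm \<Rightarrow> nat \<Rightarrow> fm" where
  "lit a k = (if k = 1 then a else Neg a)"

definition exponents :: "nat \<Rightarrow> (nat \<times> nat \<Rightarrow> nat) set" where
  "exponents n = ({1..n} \<times> {0, 1}) \<rightarrow>\<^sub>E {0, 1}"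

definition disjunct :: "nat \<Rightarrow> (nat \<times> nat \<Rightarrow> nat) \<Rightarrow> fm" where
  "disjunct n t =
     And (Conj (map (\<lambda>i. lit (Var i) (t (i, 0))) [1..<Suc n]))
         (Conj (map (\<lambda>i. lit (Dia (Var i)) (t (i, 1))) [1..<Suc n]))"

definition Theta :: "nat \<Rightarrow> fm set" where
  "Theta n = disjunct n ` exponents n"

text \<open>
  The variable $p_i$ is represented by its index. The exponent function \<open>t\<close> is
  recovered from the formula; it is unique, see \<open>theta_disjunct\<close> and
  \<open>theta_dia_disjunct\<close> below.
\<close>

definition theta :: "nat \<Rightarrow> fm \<Rightarrow> nat set" where
  "theta n a = {i \<in> {1..n}. \<exists>t\<in>exponents n. a = disjunct n t \<and> t (i, 0) = 1}"

definition theta_dia :: "nat \<Rightarrow> fm \<Rightarrow> nat set" where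
  "theta_dia n a = {i \<in> {1..n}. \<exists>t\<in>exponents n. a = disjunct n t \<and> t (i, 1) = 1}"

text \<open>Variables other than $p_1, \ldots, p_n$ are false everywhere in this model.\<close>

definition Theta_model :: "nat \<Rightarrow> fm set \<Rightarrow> fm kripke" where
  "Theta_model n W =
     \<lparr> worlds = W,
       acc = (\<lambda>a b. theta_dia n b \<subseteq> theta_dia n a),
       val = (\<lambda>i a. i \<in> theta n a) \<rparr>"

definition Disj_over :: "(nat \<Rightarrow> fm) \<Rightarrow> nat set \<Rightarrow> fm" where
  "Disj_over \<phi> K = Disj (map \<phi> (sorted_list_of_set K))"

lemma Conj_inject:
  "length as = length bs \<Longrightarrow> Conj as = Conj bs \<Longrightarrow> as = bs"
proof (induction as arbitrary: bs rule: Conj.induct)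
  case 1
  then show ?case by simp
next
  case (2 a)
  then show ?case by (cases bs) auto
next
  case (3 a b as)
  then obtain c d cs where "bs = c # d # cs"
    by (metis length_Suc_conv)
  with "3.prems" have "a = c" "length (b # as) = length (d # cs)" "Conj (b # as) = Conj (d # cs)"
    by simp_all
  with "3.IH" have "b # as = d # cs" by blast
  with \<open>a = c\<close> \<open>bs = _\<close> show ?case by simp
qed

lemma disjunct_inject:
  assumes s: "s \<in> exponents n" and t: "t \<in> exponents n"
    and eq: "disjunct n s = disjunct n t"
  shows "s = t"
proof -
  have bits: "u (i, k) \<in> {0, 1}"
    if "u \<in> exponents n" "i \<in> {1..n}" "k \<in> {0, 1}" for u i k
    using PiE_mem[OF that(1)[unfolded exponents_def], OF SigmaI[OF that(2,3)]] .
  have maps: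
      "map (\<lambda>i. lit (Var i) (s (i, 0))) [1..<Suc n] = map (\<lambda>i. lit (Var i) (t (i, 0))) [1..<Suc n]"
      "map (\<lambda>i. lit (Dia (Var i)) (s (i, 1))) [1..<Suc n] = map (\<lambda>i. lit (Dia (Var i)) (t (i, 1))) [1..<Suc n]"
    using eq unfolding disjunct_def fm.inject
    by (auto simp only: length_map intro!: Conj_inject)
  have a: "lit (Var i) (s (i, 0)) = lit (Var i) (t (i, 0))"
    and b: "lit (Dia (Var i)) (s (i, 1)) = lit (Dia (Var i)) (t (i, 1))" if "i \<in> {1..n}" for i
  proof -
    have "i \<in> set [1..<Suc n]" using that by (simp only: set_upt) auto
    then show "lit (Var i) (s (i, 0)) = lit (Var i) (t (i, 0))"
      and "lit (Dia (Var i)) (s (i, 1)) = lit (Dia (Var i)) (t (i, 1))"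
      using maps unfolding map_eq_conv by blast+
  qed
  have "s x = t x" if "x \<in> {1..n} \<times> {0, 1}" for x
  proof -
    obtain i k where x: "x = (i, k)" "i \<in> {1..n}" "k \<in> {0, 1}"
      using \<open>x \<in> _\<close> by auto
    show ?thesis
      using a[OF x(2)] b[OF x(2)] bits[OF s x(2,3)] bits[OF t x(2,3)] x(1,3)
      by (auto simp: lit_def Dia_def split: if_splits)
  qed
  then show ?thesis
    using s t unfolding exponents_def by (intro PiE_ext)
qed

lemma theta_disjunct:
  "t \<in> exponents n \<Longrightarrow> theta n (disjunct n t) = {i \<in> {1..n}. t (i, 0) = 1}"
  unfolding theta_def using disjunct_inject by blast

lemma theta_dia_disjunct:
  "t \<in> exponents n \<Longrightarrow> theta_dia n (disjunct n t) = {i \<in> {1..n}. t (i, 1) = 1}"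
  unfolding theta_dia_def using disjunct_inject by blast

end

(*
  Every world of a model of the premise satisfies exactly one disjunct, and W collects the
  disjuncts that occur.  Reflexivity and transitivity of the model make theta_dia decrease along
  accessibility and contain theta, so the inclusion order on theta_dia has exactly the diamonds
  that the disjuncts prescribe; hence every disjunct in W is true at itself.  Conversely,
  M(Theta_n, W) is a finite S4-model, so it can be copied into any infinite type.
*)
theory Submission
  imports Defs
begin

lemma sat_Conj [simp]: "sat M w (Conj as) \<longleftrightarrow> (\<forall>a\<in>set as. sat M w a)"
  by (induction as rule: Conj.induct) (auto simp: Top_def)

lemma sat_Disj [simp]: "sat M w (Disj as) \<longleftrightarrow> (\<exists>a\<in>set as. sat M w a)"
  by (induction as rule: Disj.induct) auto

lemma sat_Disj_over:
  "finite K \<Longrightarrow> sat M w (Disj_over \<phi> K) \<longleftrightarrow> (\<exists>i\<in>K. sat M w (\<phi> i))"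
  by (simp add: Disj_over_def)

lemma sat_Dia [simp]: "sat M w (Dia a) \<longleftrightarrow> (\<exists>v\<in>worlds M. acc M w v \<and> sat M v a)"
  by (simp add: Dia_def)

lemma sat_lit: "sat M w (lit a k) \<longleftrightarrow> (k = 1 \<longleftrightarrow> sat M w a)"
  by (simp add: lit_def)

text \<open>A disjunct prescribes the truth value of every \<open>Var i\<close> and every
  \<open>Dia (Var i)\<close> with \<open>i\<close> in \<open>{1..n}\<close> and nothing else. This
  turns its truth at a world into two set equations, so that later arguments compare sets instead of
  evaluating formulas.\<close>

lemma sat_Theta:
  assumes "\<psi> \<in> Theta n"
  shows "sat M w \<psi> \<longleftrightarrow>
    theta n \<psi> = {i \<in> {1..n}. val M i w} \<and>
    theta_dia n \<psi> = {i \<in> {1..n}. \<exists>v\<in>worlds M. acc M w v \<and> val M i v}"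
proof -
  obtain t where t: "t \<in> exponents n" and \<psi>: "\<psi> = disjunct n t"
    using assms by (auto simp: Theta_def)
  have range: "set [1..<Suc n] = {1..n}"
    by (simp only: set_upt) auto
  have "sat M w \<psi> \<longleftrightarrow> (\<forall>i\<in>{1..n}. t (i, 0) = 1 \<longleftrightarrow> val M i w) \<and>
      (\<forall>i\<in>{1..n}. t (i, 1) = 1 \<longleftrightarrow> (\<exists>v\<in>worlds M. acc M w v \<and> val M i v))"
    by (simp only: \<psi> disjunct_def sat.simps sat_Conj set_map range ball_simps sat_lit sat_Dia)
  also have "\<dots> \<longleftrightarrow> theta n \<psi> = {i \<in> {1..n}. val M i w} \<and>
      theta_dia n \<psi> = {i \<in> {1..n}. \<exists>v\<in>worlds M. acc M w v \<and> val M i v}"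
    unfolding \<psi> theta_disjunct[OF t] theta_dia_disjunct[OF t] set_eq_iff mem_Collect_eq by blast
  finally show ?thesis .
qed

text \<open>The two sets record where the exponent function is 1; elsewhere on its domain it is 0,
  and outside the domain \<open>PiE\<close> fixes it.\<close>

lemma Theta_eqI:
  assumes "\<psi> \<in> Theta n" and "\<chi> \<in> Theta n"
    and "theta n \<psi> = theta n \<chi>" and "theta_dia n \<psi> = theta_dia n \<chi>"
  shows "\<psi> = \<chi>"
proof -
  obtain s t where s: "s \<in> exponents n" and \<psi>: "\<psi> = disjunct n s"
    and t: "t \<in> exponents n" and \<chi>: "\<chi> = disjunct n t"
    using assms(1,2) by (auto simp: Theta_def)
  have bits: "u (i, k) \<in> {0, 1}"
    if "u \<in> exponents n" "i \<in> {1..n}" "k \<in> {0, 1}" for u i k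
    using PiE_mem[OF that(1)[unfolded exponents_def], OF SigmaI[OF that(2,3)]] .
  have iff: "s (i, k) = 1 \<longleftrightarrow> t (i, k) = 1" if "i \<in> {1..n}" "k \<in> {0, 1}" for i k
    using assms(3,4) that
    unfolding \<psi> \<chi> theta_disjunct[OF s] theta_disjunct[OF t]
      theta_dia_disjunct[OF s] theta_dia_disjunct[OF t] by blast
  have "s x = t x" if "x \<in> {1..n} \<times> {0, 1}" for x
  proof -
    obtain i k where x: "x = (i, k)" "i \<in> {1..n}" "k \<in> {0, 1}"
      using \<open>x \<in> _\<close> by auto
    show ?thesis
      using iff[OF x(2,3)] bits[OF s x(2,3)] bits[OF t x(2,3)] unfolding x(1) by auto
  qed
  then have "s = t"
    using s t unfolding exponents_def by (intro PiE_ext)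
  then show ?thesis by (simp add: \<psi> \<chi>)
qed

text \<open>By \<open>sat_Theta\<close> the world determines both sets, and these determine the
  disjunct.\<close>

lemma sat_Theta_unique:
  assumes "\<psi> \<in> Theta n" and "\<chi> \<in> Theta n" and "sat M w \<psi>" and "sat M w \<chi>"
  shows "\<psi> = \<chi>"
  using assms(3,4)
  by (intro Theta_eqI[OF assms(1,2)])
    (auto simp: sat_Theta[OF assms(1)] sat_Theta[OF assms(2)])

lemma theta_subset: "theta n \<psi> \<subseteq> {1..n}"
  by (auto simp: theta_def)

lemma theta_dia_subset: "theta_dia n \<psi> \<subseteq> {1..n}"
  by (auto simp: theta_dia_def)

lemma S4_Theta_model: "W \<noteq> {} \<Longrightarrow> S4_model (Theta_model n W)"
  by (auto simp: S4_model_def Theta_model_def intro: reflp_onI transp_onI)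

text \<open>The valuation of \<open>Theta_model\<close> is \<open>theta\<close>, so only the
  diamonds are at stake: \<open>theta_dia n \<psi>\<close> must be the union of
  \<open>theta n \<chi>\<close> over all \<open>\<chi>\<close> in \<open>W\<close> with
  \<open>theta_dia n \<chi> \<subseteq> theta_dia n \<psi>\<close>.\<close>

lemma sat_realized_Theta_model:
  assumes S4: "S4_model M"
    and W: "W = {\<psi> \<in> Theta n. \<exists>x\<in>worlds M. sat M x \<psi>}"
    and cover: "\<And>x. x \<in> worlds M \<Longrightarrow> \<exists>\<psi>\<in>W. sat M x \<psi>"
    and \<psi>: "\<psi> \<in> W"
  shows "sat (Theta_model n W) \<psi> \<psi>"
proof -
  have refl: "acc M x x" if "x \<in> worlds M" for x
    using S4 that by (auto simp: S4_model_def reflp_on_def)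
  have trans: "acc M x z"
    if "acc M x y" "acc M y z" "x \<in> worlds M" "y \<in> worlds M" "z \<in> worlds M" for x y z
    using S4 that unfolding S4_model_def transp_on_def by blast
  have in_Theta: "\<chi> \<in> Theta n" if "\<chi> \<in> W" for \<chi>
    using that W by blast
  obtain x where x: "x \<in> worlds M" "sat M x \<psi>"
    using \<psi> W by blast
  note at_x = x(2)[unfolded sat_Theta[OF in_Theta[OF \<psi>]]]
  \<comment> \<open>A diamond true at \<open>x\<close> has a witness \<open>y\<close> in
    \<open>M\<close>, and \<open>\<chi>\<close> is the disjunct realized there. By transitivity
    \<open>x\<close> sees all that \<open>y\<close> sees, so \<open>\<chi>\<close> is accessible
    from \<open>\<psi>\<close>.\<close>
  have "\<exists>\<chi>\<in>W. theta_dia n \<chi> \<subseteq> theta_dia n \<psi> \<and> i \<in> theta n \<chi>" if "i \<in> theta_dia n \<psi>" for i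
  proof -
    obtain y where y: "y \<in> worlds M" "acc M x y" "val M i y" and i: "i \<in> {1..n}"
      using \<open>i \<in> _\<close> at_x by blast
    obtain \<chi> where \<chi>: "\<chi> \<in> W" "sat M y \<chi>"
      using cover[OF y(1)] by blast
    note at_y = \<chi>(2)[unfolded sat_Theta[OF in_Theta[OF \<chi>(1)]]]
    have "i \<in> theta n \<chi>" using at_y y i by blast
    moreover have "theta_dia n \<chi> \<subseteq> theta_dia n \<psi>"
      using at_x at_y trans[OF y(2) _ x(1) y(1)] by blast
    ultimately show ?thesis using \<chi>(1) by blast
  qed
  \<comment> \<open>A world \<open>y\<close> realizing \<open>\<chi>\<close> may be unrelated to
    \<open>x\<close> in \<open>M\<close>. Reflexivity at \<open>y\<close> gives
    \<open>theta n \<chi> \<subseteq> theta_dia n \<chi>\<close>, and the assumed inclusion does the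
    rest.\<close>
  moreover have "i \<in> theta_dia n \<psi>"
    if \<chi>: "\<chi> \<in> W" and le: "theta_dia n \<chi> \<subseteq> theta_dia n \<psi>" and i: "i \<in> theta n \<chi>" for i \<chi>
  proof -
    obtain y where y: "y \<in> worlds M" "sat M y \<chi>"
      using \<chi> W by blast
    have "i \<in> theta_dia n \<chi>"
      using y(2) i refl[OF y(1)] y(1) unfolding sat_Theta[OF in_Theta[OF \<chi>]] by blast
    then show ?thesis using le by blast
  qed
  ultimately show ?thesis
    unfolding sat_Theta[OF in_Theta[OF \<psi>]]
    using theta_subset[of n \<psi>] theta_dia_subset[of n \<psi>]
    by (simp only: Theta_model_def kripke.simps) (intro conjI set_eqI iffI; blast)
qed

text \<open>An isomorphic copy of \<open>M\<close> when \<open>f\<close> is injective on its worlds.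
  It is needed because \<open>Theta_model\<close> has formulas as worlds, whereas the theorem asks
  for a model over \<open>'w\<close>.\<close>

definition image_model :: "('a \<Rightarrow> 'b) \<Rightarrow> 'a kripke \<Rightarrow> 'b kripke" where
  "image_model f M =
     \<lparr> worlds = f ` worlds M,
       acc = (\<lambda>a b. acc M (inv_into (worlds M) f a) (inv_into (worlds M) f b)),
       val = (\<lambda>i a. val M i (inv_into (worlds M) f a)) \<rparr>"

lemma sat_image_model:
  assumes "inj_on f (worlds M)" and "w \<in> worlds M"
  shows "sat (image_model f M) (f w) a \<longleftrightarrow> sat M w a"
  using assms(2) by (induction a arbitrary: w) (auto simp: image_model_def assms(1))

lemma rule_valid_image_model:
  assumes "inj_on f (worlds M)"
  shows "rule_valid (image_model f M) r \<longleftrightarrow> rule_valid M r"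
proof -
  have "worlds (image_model f M) = f ` worlds M"
    by (simp add: image_model_def)
  then have "true_in (image_model f M) a \<longleftrightarrow> true_in M a" for a
    using sat_image_model[OF assms] by (auto simp: true_in_def)
  then show ?thesis by (simp add: rule_valid_def)
qed

lemma S4_image_model:
  assumes "inj_on f (worlds M)" and "S4_model M"
  shows "S4_model (image_model f M)"
proof -
  have worlds: "worlds (image_model f M) = f ` worlds M"
    by (simp add: image_model_def)
  have acc: "acc (image_model f M) (f x) (f y) \<longleftrightarrow> acc M x y"
    if "x \<in> worlds M" "y \<in> worlds M" for x y
    using that by (simp add: image_model_def inv_into_f_f[OF assms(1)])
  have ne: "worlds M \<noteq> {}" and refl: "reflp_on (worlds M) (acc M)"
    and trans: "transp_on (worlds M) (acc M)"
    using assms(2) by (simp_all add: S4_model_def)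
  have "reflp_on (f ` worlds M) (acc (image_model f M))"
    by (rule reflp_onI) (use acc reflp_onD[OF refl] in blast)
  moreover have "transp_on (f ` worlds M) (acc (image_model f M))"
  proof (rule transp_onI)
    fix a b c
    assume "a \<in> f ` worlds M" "b \<in> f ` worlds M" "c \<in> f ` worlds M"
    then obtain x y z where xyz: "x \<in> worlds M" "y \<in> worlds M" "z \<in> worlds M"
      and abc: "a = f x" "b = f y" "c = f z"
      by blast
    assume "acc (image_model f M) a b" "acc (image_model f M) b c"
    then show "acc (image_model f M) a c"
      using transp_onD[OF trans xyz] unfolding abc acc[OF xyz(1,2)] acc[OF xyz(2,3)] acc[OF xyz(1,3)]
      by blast
  qed
  ultimately show ?thesis
    using ne unfolding S4_model_def worlds by blast
qed

theorem theorem3p4: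
  fixes n s :: nat and \<phi> :: "nat \<Rightarrow> fm" and I J :: "nat set"
  assumes "infinite (UNIV :: 'w set)"
    and "bij_betw \<phi> {1..s} (Theta n)"
    and "I \<subseteq> {1..s}" and "J \<subseteq> {1..s}"
    and "r = (Or (Disj_over \<phi> I) (Disj_over \<phi> J), Disj_over \<phi> J)"
  shows "(\<exists>M :: 'w kripke. S4_model M \<and> \<not> rule_valid M r) \<longleftrightarrow>
    (\<exists>W \<subseteq> {\<phi> i | i. \<phi> i \<in> Theta n \<and> i \<in> I \<union> J}.
       (\<forall>\<psi>\<in>W. sat (Theta_model n W) \<psi> \<psi>) \<and>
       true_in (Theta_model n W) (Or (Disj_over \<phi> I) (Disj_over \<phi> J)) \<and>
       (\<exists>i\<in>I. \<phi> i \<in> W \<and> \<not> sat (Theta_model n W) (\<phi> i) (Disj_over \<phi> J)) \<and>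
       \<not> rule_valid (Theta_model n W) r)"
    (is "?L \<longleftrightarrow> (\<exists>W \<subseteq> ?A. ?P W)")
proof
  have fin: "finite I" "finite J"
    using assms(3,4) finite_subset by blast+
  note sat_I = sat_Disj_over[OF fin(1)] and sat_J = sat_Disj_over[OF fin(2)]
  have \<phi>_Theta: "\<phi> i \<in> Theta n" if "i \<in> I \<union> J" for i
    using assms(2,3,4) that by (auto simp: bij_betw_def)
  {
    assume ?L
    then obtain M :: "'w kripke" where M: "S4_model M" and "\<not> rule_valid M r"
      by blast
    then have prem: "\<And>y. y \<in> worlds M \<Longrightarrow> \<exists>i\<in>I \<union> J. sat M y (\<phi> i)"
      and "\<exists>x\<in>worlds M. \<forall>j\<in>J. \<not> sat M x (\<phi> j)"
      unfolding assms(5) rule_valid_def true_in_def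
      by (simp_all add: sat_I sat_J) blast+
    then obtain x where x: "x \<in> worlds M" "\<And>j. j \<in> J \<Longrightarrow> \<not> sat M x (\<phi> j)"
      by blast
    define W where "W = {\<psi> \<in> Theta n. \<exists>x\<in>worlds M. sat M x \<psi>}"
    let ?T = "Theta_model n W"
    have cover: "\<exists>\<psi>\<in>W. sat M y \<psi>" if "y \<in> worlds M" for y
      using prem[OF that] \<phi>_Theta that unfolding W_def by blast
    \<comment> \<open>At a world realizing \<open>\<psi>\<close> the premise supplies some true
      \<open>\<phi> i\<close>, and uniqueness identifies the two. Hence \<open>W\<close> stays
      within the disjuncts indexed by \<open>I \<union> J\<close>.\<close>
    have W_eq: "\<exists>i\<in>I \<union> J. \<psi> = \<phi> i" if "\<psi> \<in> W" for \<psi>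
    proof -
      from that obtain y where y: "\<psi> \<in> Theta n" "y \<in> worlds M" "sat M y \<psi>"
        unfolding W_def by blast
      obtain i where i: "i \<in> I \<union> J" "sat M y (\<phi> i)"
        using prem[OF y(2)] by blast
      show ?thesis
        using sat_Theta_unique[OF y(1) \<phi>_Theta[OF i(1)] y(3) i(2)] i(1) by blast
    qed
    have self: "sat ?T \<psi> \<psi>" if "\<psi> \<in> W" for \<psi>
      using sat_realized_Theta_model[OF M W_def cover that] .
    have true_prem: "true_in ?T (Or (Disj_over \<phi> I) (Disj_over \<phi> J))"
      unfolding true_in_def
    proof
      fix \<psi> assume "\<psi> \<in> worlds ?T"
      then have \<psi>: "\<psi> \<in> W" by (simp add: Theta_model_def)
      obtain k where k: "k \<in> I \<union> J" "\<psi> = \<phi> k"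
        using W_eq[OF \<psi>] by blast
      have "sat ?T \<psi> (\<phi> k)"
        using self[OF \<psi>] k(2) by simp
      then show "sat ?T \<psi> (Or (Disj_over \<phi> I) (Disj_over \<phi> J))"
        using k(1) unfolding sat.simps sat_I sat_J by blast
    qed
    \<comment> \<open>The world \<open>x\<close> refutes every \<open>\<phi> j\<close> with
      \<open>j\<close> in \<open>J\<close>, so the index given by the premise lies in
      \<open>I\<close>. This \<open>\<phi> i\<close> is the world at which the conclusion fails in
      \<open>?T\<close>.\<close>
    obtain i where i: "i \<in> I" "sat M x (\<phi> i)"
      using prem[OF x(1)] x(2) by blast
    then have iW: "\<phi> i \<in> W"
      using \<phi>_Theta x(1) unfolding W_def by blast
    have not_J: "\<not> sat ?T (\<phi> i) (Disj_over \<phi> J)"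
    proof
      assume "sat ?T (\<phi> i) (Disj_over \<phi> J)"
      then obtain j where j: "j \<in> J" "sat ?T (\<phi> i) (\<phi> j)"
        by (auto simp: sat_J)
      \<comment> \<open>Since \<open>\<phi> i\<close> is true at itself, no other disjunct can be
        true there; but \<open>x\<close> separates \<open>\<phi> i\<close> from
        \<open>\<phi> j\<close>.\<close>
      then have "\<phi> i = \<phi> j"
        using sat_Theta_unique[OF \<phi>_Theta \<phi>_Theta self[OF iW] j(2)] i(1) by blast
      then show False using i(2) x(2) j(1) by simp
    qed
    have "\<not> rule_valid ?T r"
      using true_prem not_J iW assms(5)
      by (auto simp: rule_valid_def true_in_def Theta_model_def)
    moreover have "W \<subseteq> ?A"
      using W_eq \<phi>_Theta by blast
    ultimately show "\<exists>W \<subseteq> ?A. ?P W"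
      using self true_prem i(1) iW not_J by blast
  }
  {
    assume "\<exists>W \<subseteq> ?A. ?P W"
    \<comment> \<open>Nonemptiness comes from condition (3), which places some
      \<open>\<phi> i\<close> in \<open>W\<close>.\<close>
    then obtain W where W: "W \<subseteq> ?A" "W \<noteq> {}" and invalid: "\<not> rule_valid (Theta_model n W) r"
      by blast
    have "finite W"
      using fin by (intro finite_subset[OF W(1)]) simp
    \<comment> \<open>The infinite type \<open>'w\<close> has a subset of the size of the finite set
      \<open>W\<close>; a bijection onto it is the injection along which the model is
      copied.\<close>
    then obtain B :: "'w set" where "finite B" "card B = card W"
      using infinite_arbitrarily_large[OF assms(1)] by blast
    then obtain f where "bij_betw f W B"
      using \<open>finite W\<close> by (metis finite_same_card_bij)
    then have inj: "inj_on f (worlds (Theta_model n W))"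
      by (simp add: bij_betw_def Theta_model_def)
    show ?L
      using S4_image_model[OF inj S4_Theta_model[OF W(2)]] invalid
        rule_valid_image_model[OF inj] by blast
  }
qed

end
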